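(* Let $I\subset[0,\infty)$ be an interval, let $f:I\to\mathbb{R}$ be differentiable on the interior $I^{\circ}$, and let $a,b\in I^{\circ}$ with $a<b$ be such that $f'\in L[a,b]$. Let $s\in(0,1]$ and suppose $|f'|^{q}$ is $s$-convex (in the second sense) on $[a,b]$ for some fixed $q\geq1$. Let $x\in[a,b]$, $\lambda\in[0,1]$, $\alpha>0$. Then $$|S_{f}(x,\lambda,\alpha,a,b)|\leq A_{1}(\alpha,\lambda)^{1-\frac1q}\Big\{\frac{(x-a)^{\alpha+1}}{b-a}\big(|f'(x)|^{q}A_{2}(\alpha,\lambda,s)+|f'(a)|^{q}A_{3}(\alpha,\lambda,s)\big)^{\frac1q}+\frac{(b-x)^{\alpha+1}}{b-a}\big(|f'(x)|^{q}A_{2}(\alpha,\lambda,s)+|f'(b)|^{q}A_{3}(\alpha,\lambda,s)\big)^{\frac1q}\Big\},$$ where $$A_{1}(\alpha,\lambda)=\frac{2\alpha\lambda^{1+\frac1\alpha}+1}{\alpha+1}-\lambda,\qquad A_{2}(\alpha,\lambda,s)=\frac{2\alpha\lambda^{1+\frac{s+1}{\alpha}}+s+1}{(s+1)(\alpha+s+1)}-\frac{\lambda}{s+1},$$ $$A_{3}(\alpha,\lambda,s)=\lambda\left[\frac{1-2\left(1-\lambda^{\frac1\alpha}\right)^{s+1}}{s+1}\right]+\beta(\alpha+1,s+1)-2\beta\left(\lambda^{\frac1\alpha};\alpha+1,s+1\right).$$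
   Context: A function $g$ is $s$-convex in the second sense on $[a,b]\subset[0,\infty)$, $s\in(0,1]$, if $g(tu+(1-t)v)\le t^{s}g(u)+(1-t)^{s}g(v)$ for all $u,v\in[a,b]$, $t\in[0,1]$. $\Gamma$ is the Euler Gamma function, $\beta(p,r)=\int_{0}^{1}t^{p-1}(1-t)^{r-1}dt$ ($p,r>0$) is the Beta function, and $\beta(z;p,r)=\int_{0}^{z}t^{p-1}(1-t)^{r-1}dt$ ($0\le z\le1$) is the incomplete Beta function. For $\alpha>0$ and $x\in[a,b]$: $J_{x^{-}}^{\alpha}f(a)=\frac{1}{\Gamma(\alpha)}\int_{a}^{x}(t-a)^{\alpha-1}f(t)\,dt$ and $J_{x^{+}}^{\alpha}f(b)=\frac{1}{\Gamma(\alpha)}\int_{x}^{b}(b-t)^{\alpha-1}f(t)\,dt$ (equal to $0$ when the interval of integration is a single point). Define $$S_{f}(x,\lambda,\alpha,a,b)=(1-\lambda)\frac{(x-a)^{\alpha}+(b-x)^{\alpha}}{b-a}f(x)+\lambda\frac{(x-a)^{\alpha}f(a)+(b-x)^{\alpha}f(b)}{b-a}-\frac{\Gamma(\alpha+1)}{b-a}\left[J_{x^{-}}^{\alpha}f(a)+J_{x^{+}}^{\alpha}f(b)\right].$$ *)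

theory Defs
  imports "HOL-Analysis.Analysis"
begin

definition s_convex_on :: "real \<Rightarrow> real set \<Rightarrow> (real \<Rightarrow> real) \<Rightarrow> bool" where
  "s_convex_on s A g \<longleftrightarrow>
     (\<forall>u\<in>A. \<forall>v\<in>A. \<forall>t\<in>{0..1}.
        g (t * u + (1 - t) * v) \<le> t powr s * g u + (1 - t) powr s * g v)"

text \<open>The complete Beta function is the library constant \<^const>\<open>Beta\<close>, which is defined through the
  Gamma function; \<open>inc_beta_1\<close> below confirms that it is the Euler integral for positive parameters.\<close>

definition inc_beta :: "real \<Rightarrow> real \<Rightarrow> real \<Rightarrow> real" where
  "inc_beta z p r = (LINT t:{0..z}|lebesgue. t powr (p - 1) * (1 - t) powr (r - 1))"

lemma inc_beta_1:
  assumes "p > 0" "r > 0"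
  shows "inc_beta 1 p r = Beta p r"
proof -
  have H: "((\<lambda>t. t powr (p - 1) * (1 - t) powr (r - 1)) has_integral Beta p r) {0..1}"
    using has_integral_Beta_real[OF assms] .
  then have "(\<lambda>t. t powr (p - 1) * (1 - t) powr (r - 1)) absolutely_integrable_on {0..1::real}"
    by (intro nonnegative_absolutely_integrable_1) (auto simp: integrable_on_def)
  from set_lebesgue_integral_eq_integral(2)[OF this] H show ?thesis
    by (simp add: inc_beta_def integral_unique)
qed

text \<open>Riemann--Liouville fractional integrals: with \<open>u \<le> x \<le> v\<close>,
  \<open>rl_integral_minus \<alpha> x f u\<close> is the operator with superscript \<open>\<alpha>\<close> and subscript \<open>x-\<close> evaluated at \<open>u\<close>,
  and \<open>rl_integral_plus \<alpha> x f v\<close> is the one with subscript \<open>x+\<close> evaluated at \<open>v\<close>.\<close>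

definition rl_integral_minus :: "real \<Rightarrow> real \<Rightarrow> (real \<Rightarrow> real) \<Rightarrow> real \<Rightarrow> real" where
  "rl_integral_minus \<alpha> x f u =
     1 / Gamma \<alpha> * (LINT t:{u..x}|lebesgue. (t - u) powr (\<alpha> - 1) * f t)"

definition rl_integral_plus :: "real \<Rightarrow> real \<Rightarrow> (real \<Rightarrow> real) \<Rightarrow> real \<Rightarrow> real" where
  "rl_integral_plus \<alpha> x f v =
     1 / Gamma \<alpha> * (LINT t:{x..v}|lebesgue. (v - t) powr (\<alpha> - 1) * f t)"

definition S_f :: "(real \<Rightarrow> real) \<Rightarrow> real \<Rightarrow> real \<Rightarrow> real \<Rightarrow> real \<Rightarrow> real \<Rightarrow> real" where
  "S_f f x lam \<alpha> a b =
     (1 - lam) * (((x - a) powr \<alpha> + (b - x) powr \<alpha>) / (b - a)) * f x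
     + lam * (((x - a) powr \<alpha> * f a + (b - x) powr \<alpha> * f b) / (b - a))
     - Gamma (\<alpha> + 1) / (b - a) * (rl_integral_minus \<alpha> x f a + rl_integral_plus \<alpha> x f b)"

definition A1 :: "real \<Rightarrow> real \<Rightarrow> real" where
  "A1 \<alpha> lam = (2 * \<alpha> * lam powr (1 + 1 / \<alpha>) + 1) / (\<alpha> + 1) - lam"

definition A2 :: "real \<Rightarrow> real \<Rightarrow> real \<Rightarrow> real" where
  "A2 \<alpha> lam s =
     (2 * \<alpha> * lam powr (1 + (s + 1) / \<alpha>) + s + 1) / ((s + 1) * (\<alpha> + s + 1)) - lam / (s + 1)"

definition A3 :: "real \<Rightarrow> real \<Rightarrow> real \<Rightarrow> real" where
  "A3 \<alpha> lam s =
     lam * ((1 - 2 * (1 - lam powr (1 / \<alpha>)) powr (s + 1)) / (s + 1))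
     + Beta (\<alpha> + 1) (s + 1) - 2 * inc_beta (lam powr (1 / \<alpha>)) (\<alpha> + 1) (s + 1)"

end

theory Submission
  imports Defs
begin

text \<open>Integrating the derivative of \<open>(t\<^sup>\<alpha> - \<lambda>) f(t x + (1 - t) u)\<close> over \<open>[0,1]\<close> for \<open>u = a\<close> and \<open>u = b\<close> expresses
  \<open>S_f\<close> through the integrals of \<open>(t\<^sup>\<alpha> - \<lambda>) f'(t x + (1 - t) u)\<close>. These are bounded by the power mean
  inequality with weight \<open>\<bar>t\<^sup>\<alpha> - \<lambda>\<bar>\<close> and \<open>s\<close>-convexity; \<open>A1\<close>, \<open>A2\<close>, \<open>A3\<close> are the integrals of
  this weight against \<open>1\<close>, \<open>t\<^sup>s\<close>, \<open>(1 - t)\<^sup>s\<close>, computed by splitting at the zero \<open>\<lambda>\<close> to the \<open>1/\<alpha>\<close> of the weight.\<close>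

section \<open>Moments of the weight \<open>\<bar>t powr \<alpha> - lam\<bar>\<close> on the unit
  interval\<close>

lemma has_integral_abs_powr_diff_mult:
  fixes \<phi> :: "real \<Rightarrow> real"
  assumes "0 < \<alpha>" and lam: "lam \<in> {0..1}"
    and nonneg: "\<And>t. t \<in> {0..1} \<Longrightarrow> 0 \<le> \<phi> t"
    and \<phi>: "\<And>z. z \<in> {0..1} \<Longrightarrow> (\<phi> has_integral F z) {0..z}"
    and \<psi>: "\<And>z. z \<in> {0..1} \<Longrightarrow> ((\<lambda>t. t powr \<alpha> * \<phi> t) has_integral G z) {0..z}"
  shows "((\<lambda>t. \<bar>t powr \<alpha> - lam\<bar> * \<phi> t) has_integral
     (G 1 - lam * F 1 + 2 * (lam * F (lam powr (1 / \<alpha>)) - G (lam powr (1 / \<alpha>))))) {0..1}"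
proof -
  define c where "c = lam powr (1 / \<alpha>)"
  have c: "c \<in> {0..1}"
    using lam assms(1) by (auto simp: c_def powr_le1)
  have c_powr: "c powr \<alpha> = lam"
    using lam assms(1) by (simp add: c_def powr_powr)
  \<comment> \<open>An absolute value is the quantity plus twice its negative part. The negative
    part of \<open>t powr \<alpha> - lam\<close> lives on \<open>{0..c}\<close>; extended by zero,
    it brings in only the values of \<open>F\<close> and \<open>G\<close> at
    \<open>c\<close>.\<close>
  have "((\<lambda>t. if t \<in> {0..c} then lam * \<phi> t - t powr \<alpha> * \<phi> t else 0) has_integral (lam * F c - G c)) {0..1}"
    unfolding has_integral_restrict_Int
    using has_integral_diff[OF has_integral_mult_right[OF \<phi>[OF c]] \<psi>[OF c]] c
    by (simp add: Int_absorb2)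
  then have "((\<lambda>t. (t powr \<alpha> * \<phi> t - lam * \<phi> t) + 2 * (if t \<in> {0..c} then lam * \<phi> t - t powr \<alpha> * \<phi> t else 0))
      has_integral (G 1 - lam * F 1 + 2 * (lam * F c - G c))) {0..1}"
    by (intro has_integral_add has_integral_diff has_integral_mult_right \<phi> \<psi>) auto
  moreover have "\<bar>t powr \<alpha> - lam\<bar> * \<phi> t =
      (t powr \<alpha> * \<phi> t - lam * \<phi> t) + 2 * (if t \<in> {0..c} then lam * \<phi> t - t powr \<alpha> * \<phi> t else 0)"
    if t: "t \<in> {0..1}" for t
  proof (cases "t \<le> c")
    case True
    then have "t powr \<alpha> \<le> lam"
      using t assms(1) powr_mono2[of \<alpha> t c] c_powr by auto
    then show ?thesis using True t by (auto simp: algebra_simps)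
  next
    case False
    then have "lam \<le> t powr \<alpha>"
      using t assms(1) powr_mono2[of \<alpha> c t] c_powr c by auto
    then show ?thesis using False t by (auto simp: algebra_simps)
  qed
  ultimately show ?thesis
    unfolding c_def by (subst has_integral_cong) auto
qed

lemma powr_root_eqs:
  fixes lam \<alpha> r :: real
  assumes "0 < \<alpha>" "0 \<le> lam"
  shows "lam * (lam powr (1 / \<alpha>)) powr r = lam powr (1 + r / \<alpha>)"
    and "(lam powr (1 / \<alpha>)) powr (\<alpha> + r) = lam powr (1 + r / \<alpha>)"
proof -
  show "lam * (lam powr (1 / \<alpha>)) powr r = lam powr (1 + r / \<alpha>)"
    using assms by (simp add: powr_powr powr_add)
  have "(1 / \<alpha>) * (\<alpha> + r) = 1 + r / \<alpha>"
    using assms by (simp add: field_simps)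
  then show "(lam powr (1 / \<alpha>)) powr (\<alpha> + r) = lam powr (1 + r / \<alpha>)"
    by (simp add: powr_powr)
qed

lemma has_integral_A1:
  assumes "0 < \<alpha>" "lam \<in> {0..1}"
  shows "((\<lambda>t. \<bar>t powr \<alpha> - lam\<bar>) has_integral A1 \<alpha> lam) {0..1}"
proof -
  let ?c = "lam powr (1 / \<alpha>)"
  have "((\<lambda>t. \<bar>t powr \<alpha> - lam\<bar> * 1) has_integral
     (1 powr (\<alpha> + 1) / (\<alpha> + 1) - lam * 1 + 2 * (lam * ?c - ?c powr (\<alpha> + 1) / (\<alpha> + 1)))) {0..1}"
  proof (rule has_integral_abs_powr_diff_mult)
    show "((\<lambda>_. 1) has_integral z) {0..z}" if "z \<in> {0..1}" for z :: real
      using that has_integral_const_real[of "1::real" 0 z] by simp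
  qed (use assms in \<open>auto intro!: has_integral_powr_from_0\<close>)
  moreover have "?c powr (\<alpha> + 1) = lam powr (1 + 1 / \<alpha>)" "lam * ?c = lam powr (1 + 1 / \<alpha>)"
    using assms powr_root_eqs[of \<alpha> lam 1] by (auto split: if_splits)
  \<comment> \<open>\<open>L\<close> stands for \<open>lam powr (1 + 1 / \<alpha>)\<close>; both
    boundary terms at \<open>?c\<close> reduce to it, so a rational identity in \<open>L\<close>
    remains.\<close>
  moreover have "1 powr (\<alpha> + 1) / (\<alpha> + 1) - lam * 1 + 2 * (L - L / (\<alpha> + 1)) =
      (2 * \<alpha> * L + 1) / (\<alpha> + 1) - lam" for L
    using assms by (simp add: divide_simps) (simp add: algebra_simps)
  ultimately show ?thesis
    by (simp only: A1_def mult_1_right)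
qed

lemma has_integral_A2:
  assumes "0 < \<alpha>" "lam \<in> {0..1}" "0 < s"
  shows "((\<lambda>t. \<bar>t powr \<alpha> - lam\<bar> * t powr s) has_integral A2 \<alpha> lam s) {0..1}"
proof -
  let ?c = "lam powr (1 / \<alpha>)"
  have "((\<lambda>t. \<bar>t powr \<alpha> - lam\<bar> * t powr s) has_integral
     (1 powr (\<alpha> + s + 1) / (\<alpha> + s + 1) - lam * (1 powr (s + 1) / (s + 1))
       + 2 * (lam * (?c powr (s + 1) / (s + 1)) - ?c powr (\<alpha> + s + 1) / (\<alpha> + s + 1)))) {0..1}"
    using assms
    by (intro has_integral_abs_powr_diff_mult)
       (auto intro!: has_integral_powr_from_0 simp flip: powr_add)
  moreover have "?c powr (\<alpha> + s + 1) = lam powr (1 + (s + 1) / \<alpha>)"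
    and eq: "lam * ?c powr (s + 1) = lam powr (1 + (s + 1) / \<alpha>)"
    using assms powr_root_eqs[of \<alpha> lam "s + 1"] by (auto simp: add.assoc)
  moreover have "1 powr (\<alpha> + s + 1) / (\<alpha> + s + 1) - lam * (1 powr (s + 1) / (s + 1))
        + 2 * (lam * (X / (s + 1)) - L / (\<alpha> + s + 1)) =
      (2 * \<alpha> * L + s + 1) / ((s + 1) * (\<alpha> + s + 1)) - lam / (s + 1)"
    if "lam * X = L" for L X
  proof -
    have "s + 1 \<noteq> 0" "\<alpha> + s + 1 \<noteq> 0" using assms by auto
    then show ?thesis
      unfolding that[symmetric] by (simp add: divide_simps) (simp add: algebra_simps)
  qed
  note this[OF eq]
  ultimately show ?thesis
    by (simp only: A2_def)
qed

text \<open>Passes from the Lebesgue integral in \<open>inc_beta\<close> to the gauge integral used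
  for the moments: the integrand is nonnegative, so the integrability inherited from
  \<open>{0..1}\<close> is already absolute.\<close>

lemma has_integral_inc_beta:
  assumes "0 < p" "0 < r" "z \<in> {0..1}"
  shows "((\<lambda>t. t powr (p - 1) * (1 - t) powr (r - 1)) has_integral inc_beta z p r) {0..z}"
proof -
  let ?h = "\<lambda>t::real. t powr (p - 1) * (1 - t) powr (r - 1)"
  have "?h integrable_on {0..1}"
    using has_integral_Beta_real[OF assms(1,2)] by blast
  then have "?h integrable_on {0..z}"
    by (rule integrable_on_subinterval) (use assms in auto)
  then have "?h absolutely_integrable_on {0..z}"
    by (rule nonnegative_absolutely_integrable_1) auto
  from set_lebesgue_integral_eq_integral[OF this] show ?thesis
    by (simp add: inc_beta_def has_integral_integral)
qed

lemma has_integral_one_minus_powr: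
  fixes s z :: real
  assumes "0 < s" "z \<in> {0..1}"
  shows "((\<lambda>t. (1 - t) powr s) has_integral (1 - (1 - z) powr (s + 1)) / (s + 1)) {0..z}"
proof -
  have "((\<lambda>t. (1 - t) powr s) has_integral
      (- ((1 - z) powr (s + 1) / (s + 1)) - (- ((1 - 0) powr (s + 1) / (s + 1))))) {0..z}"
  \<comment> \<open>Continuity suffices at the endpoints, so no derivative of \<open>powr\<close> is
    taken at \<open>t = 1\<close>, where its base vanishes.\<close>
  proof (rule fundamental_theorem_of_calculus_interior)
    show "continuous_on {0..z} (\<lambda>t. - ((1 - t) powr (s + 1) / (s + 1)))"
      using assms by (intro continuous_intros continuous_on_powr') auto
    show "((\<lambda>t. - ((1 - t) powr (s + 1) / (s + 1))) has_vector_derivative (1 - t) powr s) (at t)"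
      if "t \<in> {0<..<z}" for t
      unfolding has_real_derivative_iff_has_vector_derivative[symmetric]
      using that assms by (auto intro!: derivative_eq_intros)
  qed (use assms in auto)
  then show ?thesis
    by (simp add: diff_divide_distrib)
qed

text \<open>The product \<open>t powr \<alpha> * (1 - t) powr s\<close> is the Beta integrand with
  parameters \<open>\<alpha> + 1\<close> and \<open>s + 1\<close>, so splitting at \<open>?c\<close>
  leaves an incomplete Beta value.\<close>

lemma has_integral_A3:
  assumes "0 < \<alpha>" "lam \<in> {0..1}" "0 < s"
  shows "((\<lambda>t. \<bar>t powr \<alpha> - lam\<bar> * (1 - t) powr s) has_integral A3 \<alpha> lam s) {0..1}"
proof -
  let ?c = "lam powr (1 / \<alpha>)"
  let ?B = "\<lambda>z. inc_beta z (\<alpha> + 1) (s + 1)"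
  let ?F = "\<lambda>z. (1 - (1 - z) powr (s + 1)) / (s + 1)"
  have "((\<lambda>t. \<bar>t powr \<alpha> - lam\<bar> * (1 - t) powr s) has_integral
     (?B 1 - lam * ?F 1 + 2 * (lam * ?F ?c - ?B ?c))) {0..1}"
    using assms has_integral_inc_beta[of "\<alpha> + 1" "s + 1"]
    by (intro has_integral_abs_powr_diff_mult)
       (auto intro!: has_integral_one_minus_powr)
  moreover have "?B 1 = Beta (\<alpha> + 1) (s + 1)"
    using assms by (intro inc_beta_1) auto
  moreover have val: "B - lam * ((1 - (1 - 1) powr (s + 1)) / (s + 1)) + 2 * (lam * ((1 - y) / (s + 1)) - b) =
      lam * ((1 - 2 * y) / (s + 1)) + B - 2 * b" for B b y
    using assms by (simp add: divide_simps) (simp add: algebra_simps)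
  ultimately show ?thesis
    by (simp only: A3_def val)
qed

section \<open>Positive total weight and the weighted power mean inequality\<close>

text \<open>The power mean bound divides by the total weight. For \<open>lam > 0\<close>, weighted
  AM-GM for \<open>L = lam powr (1 + 1 / \<alpha>)\<close> and \<open>1\<close> gives
  \<open>lam \<le> \<alpha> / (\<alpha> + 1) * L + 1 / (\<alpha> + 1)\<close>. \<open>A1\<close>
  contains the \<open>L\<close> term twice, so one positive copy is left over.\<close>

lemma A1_pos:
  assumes "0 < \<alpha>" "lam \<in> {0..1}"
  shows "0 < A1 \<alpha> lam"
proof (cases "lam = 0")
  case True
  then show ?thesis using assms by (simp add: A1_def)
next
  case False
  define L where "L = lam powr (1 + 1 / \<alpha>)"
  have L: "L > 0" using False assms by (simp add: L_def)
  have "\<alpha> / (\<alpha> + 1) + 1 / (\<alpha> + 1) = 1"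
    using assms by (subst add_divide_distrib[symmetric]) simp
  then have "L powr (\<alpha> / (\<alpha> + 1)) * 1 powr (1 / (\<alpha> + 1)) \<le> \<alpha> / (\<alpha> + 1) * L + 1 / (\<alpha> + 1) * 1"
    using assms L by (intro Youngs_inequality_0) auto
  moreover have "L powr (\<alpha> / (\<alpha> + 1)) = lam"
  proof -
    have "(1 + 1 / \<alpha>) * (\<alpha> / (\<alpha> + 1)) = ((\<alpha> + 1) / \<alpha>) * (\<alpha> / (\<alpha> + 1))"
      using assms by (simp add: add_divide_distrib)
    also have "\<dots> = 1"
      using assms by simp
    finally have "(1 + 1 / \<alpha>) * (\<alpha> / (\<alpha> + 1)) = 1" .
    then show ?thesis
      using assms by (simp only: L_def powr_powr) simp
  qed
  moreover have "0 < \<alpha> / (\<alpha> + 1) * L"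
    using L assms by simp
  moreover have "A1 \<alpha> lam = 2 * (\<alpha> / (\<alpha> + 1) * L) + 1 / (\<alpha> + 1) - lam"
    by (simp add: A1_def L_def add_divide_distrib)
  moreover have "0 < A" if "l * 1 \<le> M + r * 1" "l = lam" "0 < M" "A = 2 * M + r - lam" for A l M r :: real
    using that by simp
  ultimately show ?thesis unfolding powr_one_eq_one by blast
qed

text \<open>The right side is the tangent at \<open>G = K\<close> of a concave function of
  \<open>G\<close>. Being affine in \<open>G\<close>, it can be integrated, while \<open>K\<close>
  stays free to be chosen.\<close>

lemma powr_inverse_young:
  fixes G K q :: real
  assumes "0 \<le> G" "0 < K" "1 \<le> q"
  shows "G powr (1 / q) * K powr (1 - 1 / q) \<le> G / q + (1 - 1 / q) * K"
proof (cases "G = 0")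
  case True
  then show ?thesis using assms by simp
next
  case False
  then show ?thesis
    using Youngs_inequality_0[of "1 / q" "1 - 1 / q" G K] assms by simp
qed

text \<open>Integrate Young's inequality with the parameter \<open>(B + e) / A\<close> and let \<open>e\<close> tend to \<open>0\<close>;
  the shift by \<open>e\<close> is only there for the case \<open>B = 0\<close>.\<close>

lemma weighted_power_mean_integral_le:
  fixes w g G :: "real \<Rightarrow> real"
  assumes wg: "(\<lambda>t. w t * g t) integrable_on S"
    and A: "((\<lambda>t. \<bar>w t\<bar>) has_integral A) S" "0 < A"
    and B: "((\<lambda>t. \<bar>w t\<bar> * G t) has_integral B) S"
    and g: "\<And>t. t \<in> S \<Longrightarrow> \<bar>g t\<bar> powr q \<le> G t"
    and q: "1 \<le> q"
  shows "\<bar>integral S (\<lambda>t. w t * g t)\<bar> \<le> A powr (1 - 1 / q) * B powr (1 / q)"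
proof -
  let ?R = "\<bar>integral S (\<lambda>t. w t * g t)\<bar>"
  have G: "0 \<le> G t" if "t \<in> S" for t
    using g[OF that] powr_ge_zero[of "\<bar>g t\<bar>" q] by linarith
  have B0: "0 \<le> B"
    by (rule has_integral_nonneg[OF B]) (use G in auto)
  have gG: "\<bar>g t\<bar> \<le> G t powr (1 / q)" if "t \<in> S" for t
  proof -
    have "\<bar>g t\<bar> = (\<bar>g t\<bar> powr q) powr (1 / q)"
      using q by (simp add: powr_powr)
    also have "\<dots> \<le> G t powr (1 / q)"
      using g[OF that] q by (intro powr_mono2) auto
    finally show ?thesis .
  qed
  have *: "?R \<le> A powr (1 - 1 / q) * (B + e) powr (1 / q)" if e: "e > 0" for e
  proof -
    define K where "K = (B + e) / A"
    have K: "K > 0" using B0 e A by (simp add: K_def)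
    let ?k = "K powr (1 - 1 / q)"
    have bound: "((\<lambda>t. (1 / q) * (\<bar>w t\<bar> * G t) + ((1 - 1 / q) * K) * \<bar>w t\<bar>)
        has_integral ((1 / q) * B + ((1 - 1 / q) * K) * A)) S"
      by (intro has_integral_add has_integral_mult_right A B)
    have "norm (integral S (\<lambda>t. ?k * (w t * g t))) \<le>
       integral S (\<lambda>t. (1 / q) * (\<bar>w t\<bar> * G t) + ((1 - 1 / q) * K) * \<bar>w t\<bar>)"
    proof (rule integral_norm_bound_integral)
      show "(\<lambda>t. ?k * (w t * g t)) integrable_on S"
        using wg by (rule integrable_on_mult_right)
      show "norm (?k * (w t * g t)) \<le> (1 / q) * (\<bar>w t\<bar> * G t) + ((1 - 1 / q) * K) * \<bar>w t\<bar>"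
        if t: "t \<in> S" for t
      proof -
        have "norm (?k * (w t * g t)) = \<bar>w t\<bar> * (\<bar>g t\<bar> * ?k)"
          by (simp add: abs_mult)
        also have "\<dots> \<le> \<bar>w t\<bar> * (G t powr (1 / q) * ?k)"
          using gG[OF t] by (intro mult_left_mono mult_right_mono) auto
        also have "\<dots> \<le> \<bar>w t\<bar> * (G t / q + (1 - 1 / q) * K)"
          using powr_inverse_young[OF G[OF t] K q] by (intro mult_left_mono) auto
        finally show ?thesis by (simp add: algebra_simps)
      qed
    qed (use bound in blast)
    moreover have "norm (integral S (\<lambda>t. ?k * (w t * g t))) = ?k * ?R"
      by (simp add: abs_mult)
    ultimately have "?k * ?R \<le> (1 / q) * B + ((1 - 1 / q) * K) * A"
      by (simp only: integral_unique[OF bound])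
    \<comment> \<open>Since \<open>K * A = B + e\<close>, \<open>B\<close> is at most
      \<open>K * A\<close>, and so is the convex combination of the two.\<close>
    also have "\<dots> \<le> K * A"
    proof -
      have "(1 / q) * B \<le> (1 / q) * (K * A)"
        using A q e by (intro mult_left_mono) (auto simp: K_def)
      then show ?thesis by (simp add: algebra_simps)
    qed
    \<comment> \<open>Splitting \<open>K\<close> into its powers with exponents
      \<open>1 - 1 / q\<close> and \<open>1 / q\<close> exposes the positive factor
      \<open>?k\<close>, which then cancels.\<close>
    also have "\<dots> = ?k * (K powr (1 / q) * A)"
      using K by (simp flip: powr_add mult.assoc)
    finally have "?R \<le> K powr (1 / q) * A"
      using K by simp
    also have "\<dots> = A powr (1 - 1 / q) * (B + e) powr (1 / q)"
      using A B0 e by (simp add: K_def powr_divide powr_diff)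
    finally show ?thesis .
  qed
  \<comment> \<open>The exponent \<open>1 / q\<close> is positive, so the power is continuous down
    to base \<open>0\<close>, which covers \<open>B = 0\<close>.\<close>
  have "((\<lambda>e. A powr (1 - 1 / q) * (B + e) powr (1 / q)) \<longlongrightarrow>
      A powr (1 - 1 / q) * (B + 0) powr (1 / q)) (at_right 0)"
    using q B0
    by (intro tendsto_intros tendsto_powr') (auto simp: eventually_at_right_less intro!: eventually_at_rightI[of 0 1])
  then have "?R \<le> A powr (1 - 1 / q) * (B + 0) powr (1 / q)"
    by (rule tendsto_lowerbound) (use * in \<open>auto intro!: eventually_at_rightI[of 0 1]\<close>)
  then show ?thesis by simp
qed

section \<open>Estimate along the segment from \<open>u\<close> to \<open>x\<close>\<close>

lemma closed_segment_param:
  fixes u x :: real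
  assumes "t \<in> {0..1}"
  shows "t * x + (1 - t) * u \<in> closed_segment u x"
  using assms unfolding closed_segment_def by (intro CollectI exI[of _ t]) (auto simp: algebra_simps)

text \<open>For \<open>\<alpha> < 1\<close> the kernel is unbounded near \<open>0\<close>, but it is
  nonnegative and integrable, hence absolutely integrable; a bounded measurable factor preserves
  this.\<close>

lemma powr_mult_segment_integrable:
  fixes f :: "real \<Rightarrow> real"
  assumes "0 < \<alpha>" "continuous_on (closed_segment u x) f"
  shows "(\<lambda>t. t powr (\<alpha> - 1) * f (t * x + (1 - t) * u)) integrable_on {0..1}"
proof -
  have cont: "continuous_on {0..1} (\<lambda>t. f (t * x + (1 - t) * u))"
    by (rule continuous_on_compose2[OF assms(2)])
       (auto intro!: continuous_intros closed_segment_param)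
  have "(\<lambda>t. t powr (\<alpha> - 1)) integrable_on {0..1::real}"
    using has_integral_powr_from_0[of "\<alpha> - 1" 1] assms by auto
  then have "(\<lambda>t. t powr (\<alpha> - 1)) absolutely_integrable_on {0..1::real}"
    by (rule nonnegative_absolutely_integrable_1) auto
  then have "(\<lambda>t. f (t * x + (1 - t) * u) * t powr (\<alpha> - 1)) absolutely_integrable_on {0..1}"
    using cont
    by (intro absolutely_integrable_bounded_measurable_product_real)
       (auto intro: continuous_imp_measurable_on_sets_lebesgue compact_imp_bounded compact_continuous_image)
  then show ?thesis
    by (auto simp: mult.commute dest: set_lebesgue_integral_eq_integral(1))
qed

text \<open>Working on \<open>closed_segment u x\<close> leaves the order of \<open>u\<close> and
  \<open>x\<close> open, so one statement serves both \<open>u = a\<close> and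
  \<open>u = b\<close>.\<close>

lemma segment_trapezoid_bound:
  fixes f D :: "real \<Rightarrow> real"
  assumes "0 < \<alpha>" and lam: "lam \<in> {0..1}" and s: "0 < s" and q: "1 \<le> q"
    and D: "\<And>y. y \<in> closed_segment u x \<Longrightarrow> (f has_real_derivative D y) (at y)"
    and conv: "\<And>t. t \<in> {0..1} \<Longrightarrow>
       \<bar>D (t * x + (1 - t) * u)\<bar> powr q \<le> t powr s * P + (1 - t) powr s * Q"
  shows "\<bar>(1 - lam) * f x + lam * f u
      - \<alpha> * integral {0..1} (\<lambda>t. t powr (\<alpha> - 1) * f (t * x + (1 - t) * u))\<bar>
    \<le> \<bar>x - u\<bar> * (A1 \<alpha> lam powr (1 - 1 / q) * (P * A2 \<alpha> lam s + Q * A3 \<alpha> lam s) powr (1 / q))"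
proof (cases "x = u")
  \<comment> \<open>Here both sides are zero; the other case divides by the chain rule factor
    \<open>x - u\<close>.\<close>
  case True
  have "t * x + (1 - t) * u = u" for t
    using True by (simp add: algebra_simps)
  moreover have "((\<lambda>t. t powr (\<alpha> - 1) * f u) has_integral 1 / \<alpha> * f u) {0..1}"
    using has_integral_mult_left[OF has_integral_powr_from_0[of "\<alpha> - 1" 1], of "f u"] assms(1)
    by simp
  ultimately have J: "integral {0..1} (\<lambda>t. t powr (\<alpha> - 1) * f (t * x + (1 - t) * u)) = 1 / \<alpha> * f u"
    by (simp only: integral_unique)
  show ?thesis
    unfolding J using True assms(1) by (simp add: algebra_simps)
next
  case False
  let ?p = "\<lambda>t. t * x + (1 - t) * u"
  let ?J = "integral {0..1} (\<lambda>t. t powr (\<alpha> - 1) * f (?p t))"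
  let ?E = "(1 - lam) * f x + lam * f u - \<alpha> * ?J"
  have contf: "continuous_on (closed_segment u x) f"
    using D by (meson DERIV_isCont continuous_at_imp_continuous_on)
  \<comment> \<open>Because \<open>0 powr \<alpha> = 0\<close>, the boundary term at
    \<open>0\<close> contributes \<open>lam * f u\<close>, and the one at \<open>1\<close>
    contributes \<open>(1 - lam) * f x\<close>.\<close>
  have "((\<lambda>t. \<alpha> * (t powr (\<alpha> - 1) * f (?p t)) + (x - u) * ((t powr \<alpha> - lam) * D (?p t)))
     has_integral ((1 powr \<alpha> - lam) * f (?p 1) - (0 powr \<alpha> - lam) * f (?p 0))) {0..1}"
  proof (rule fundamental_theorem_of_calculus_interior)
    show "continuous_on {0..1} (\<lambda>t. (t powr \<alpha> - lam) * f (?p t))"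
      using assms(1)
      by (intro continuous_intros continuous_on_powr' continuous_on_compose2[OF contf])
         (auto intro!: closed_segment_param)
    show "((\<lambda>t. (t powr \<alpha> - lam) * f (?p t)) has_vector_derivative
        \<alpha> * (t powr (\<alpha> - 1) * f (?p t)) + (x - u) * ((t powr \<alpha> - lam) * D (?p t))) (at t)"
      if t: "t \<in> {0<..<1}" for t
    proof -
      have "(f has_real_derivative D (?p t)) (at (?p t))"
        using t by (intro D closed_segment_param) auto
      moreover have "(?p has_real_derivative (x - u)) (at t)"
        by (auto intro!: derivative_eq_intros)
      ultimately have "((\<lambda>t. f (?p t)) has_real_derivative D (?p t) * (x - u)) (at t)"
        by (rule DERIV_chain2)
      moreover have "((\<lambda>t. t powr \<alpha> - lam) has_real_derivative \<alpha> * t powr (\<alpha> - 1)) (at t)"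
        using t by (auto intro!: derivative_eq_intros)
      ultimately have "((\<lambda>t. (t powr \<alpha> - lam) * f (?p t)) has_real_derivative
          \<alpha> * t powr (\<alpha> - 1) * f (?p t) + D (?p t) * (x - u) * (t powr \<alpha> - lam)) (at t)"
        by (rule DERIV_mult[rotated])
      then show ?thesis
        unfolding has_real_derivative_iff_has_vector_derivative by (simp add: algebra_simps)
    qed
  qed auto
  \<comment> \<open>Subtracting this integrable term from the total yields both the integrability
    and the value of the \<open>D\<close> term.\<close>
  moreover have "((\<lambda>t. \<alpha> * (t powr (\<alpha> - 1) * f (?p t))) has_integral \<alpha> * ?J) {0..1}"
    by (intro has_integral_mult_right integrable_integral powr_mult_segment_integrable assms(1) contf)
  ultimately have "((\<lambda>t. (\<alpha> * (t powr (\<alpha> - 1) * f (?p t)) + (x - u) * ((t powr \<alpha> - lam) * D (?p t)))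
      - \<alpha> * (t powr (\<alpha> - 1) * f (?p t))) has_integral
      ((1 powr \<alpha> - lam) * f (?p 1) - (0 powr \<alpha> - lam) * f (?p 0)) - \<alpha> * ?J) {0..1}"
    by (rule has_integral_diff)
  then have "((\<lambda>t. (x - u) * ((t powr \<alpha> - lam) * D (?p t))) has_integral ?E) {0..1}"
    by simp
  from has_integral_mult_right[OF this, of "1 / (x - u)"] False
  have E: "((\<lambda>t. (t powr \<alpha> - lam) * D (?p t)) has_integral ?E / (x - u)) {0..1}"
    by simp
  have "((\<lambda>t. P * (\<bar>t powr \<alpha> - lam\<bar> * t powr s) + Q * (\<bar>t powr \<alpha> - lam\<bar> * (1 - t) powr s))
      has_integral (P * A2 \<alpha> lam s + Q * A3 \<alpha> lam s)) {0..1}"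
    using assms by (intro has_integral_add has_integral_mult_right has_integral_A2 has_integral_A3)
  then have "((\<lambda>t. \<bar>t powr \<alpha> - lam\<bar> * (t powr s * P + (1 - t) powr s * Q))
      has_integral (P * A2 \<alpha> lam s + Q * A3 \<alpha> lam s)) {0..1}"
    by (simp add: algebra_simps)
  then have "\<bar>integral {0..1} (\<lambda>t. (t powr \<alpha> - lam) * D (?p t))\<bar>
     \<le> A1 \<alpha> lam powr (1 - 1 / q) * (P * A2 \<alpha> lam s + Q * A3 \<alpha> lam s) powr (1 / q)"
    using E assms by (intro weighted_power_mean_integral_le has_integral_A1 A1_pos conv) auto
  then have "\<bar>?E\<bar> / \<bar>x - u\<bar> \<le> A1 \<alpha> lam powr (1 - 1 / q) * (P * A2 \<alpha> lam s + Q * A3 \<alpha> lam s) powr (1 / q)"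
    by (simp add: integral_unique[OF E] abs_divide)
  then show ?thesis
    using False by (simp add: field_simps)
qed

section \<open>Transfer to the Riemann-Liouville integrals\<close>

text \<open>This is the substitution \<open>y = t * x + (1 - t) * u\<close>; absolute values make it
  uniform in the orientation of the segment.\<close>

lemma has_integral_powr_segment:
  fixes f :: "real \<Rightarrow> real"
  assumes "0 < \<alpha>" "u \<noteq> x" "continuous_on (closed_segment u x) f"
  shows "((\<lambda>y. \<bar>y - u\<bar> powr (\<alpha> - 1) * f y) has_integral
     \<bar>x - u\<bar> powr \<alpha> * integral {0..1} (\<lambda>t. t powr (\<alpha> - 1) * f (t * x + (1 - t) * u)))
     (closed_segment u x)"
proof -
  let ?h = "\<lambda>t. t powr (\<alpha> - 1) * f (t * x + (1 - t) * u)"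
  let ?J = "integral {0..1} ?h"
  have "(?h has_integral ?J) (cbox 0 1)"
    using powr_mult_segment_integrable[OF assms(1,3)] by (simp add: has_integral_integral)
  from has_integral_affinity[OF this, of "1 / (x - u)" "- u / (x - u)"] assms(2)
  have "((\<lambda>y. ?h ((y - u) / (x - u))) has_integral \<bar>x - u\<bar> * ?J) ((\<lambda>t. (x - u) * t + u) ` {0..1})"
    by (simp add: diff_divide_distrib)
  moreover have "(\<lambda>t. (x - u) * t + u) ` {0..1} = closed_segment u x"
    unfolding closed_segment_image_interval by (intro image_cong) (auto simp: algebra_simps)
  moreover have "?h ((y - u) / (x - u)) = \<bar>x - u\<bar> powr (1 - \<alpha>) * (\<bar>y - u\<bar> powr (\<alpha> - 1) * f y)"
    if y: "y \<in> closed_segment u x" for y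
  proof -
    \<comment> \<open>On the segment \<open>y - u\<close> and \<open>x - u\<close> never have
      opposite signs.\<close>
    have "(y - u) / (x - u) = \<bar>y - u\<bar> / \<bar>x - u\<bar>"
      using y minus_divide_divide[of "y - u" "x - u"] unfolding abs_divide[symmetric]
      by (auto simp: closed_segment_eq_real_ivl zero_le_divide_iff split: if_splits)
    then have "((y - u) / (x - u)) powr (\<alpha> - 1) = \<bar>x - u\<bar> powr (1 - \<alpha>) * \<bar>y - u\<bar> powr (\<alpha> - 1)"
      using assms(2) by (simp add: powr_divide powr_diff)
    moreover have "(y - u) / (x - u) * x + (1 - (y - u) / (x - u)) * u = y"
    proof -
      have "x - u \<noteq> 0" using assms(2) by simp
      then show ?thesis
        by (simp add: divide_simps) (simp add: algebra_simps)
    qed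
    ultimately show ?thesis by simp
  qed
  ultimately have "((\<lambda>y. \<bar>x - u\<bar> powr (1 - \<alpha>) * (\<bar>y - u\<bar> powr (\<alpha> - 1) * f y)) has_integral \<bar>x - u\<bar> * ?J)
      (closed_segment u x)"
    by (metis (no_types, lifting) has_integral_cong)
  \<comment> \<open>This multiplier cancels the constant left by the kernel and turns the Jacobian
    \<open>\<bar>x - u\<bar>\<close> into \<open>\<bar>x - u\<bar> powr \<alpha>\<close>.\<close>
  from has_integral_mult_right[OF this, of "\<bar>x - u\<bar> powr (\<alpha> - 1)"]
  have "((\<lambda>y. (\<bar>x - u\<bar> powr (\<alpha> - 1) * \<bar>x - u\<bar> powr (1 - \<alpha>)) * (\<bar>y - u\<bar> powr (\<alpha> - 1) * f y)) has_integral
      (\<bar>x - u\<bar> powr (\<alpha> - 1) * \<bar>x - u\<bar>) * ?J) (closed_segment u x)"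
    by (simp only: mult.assoc)
  moreover have "\<bar>x - u\<bar> powr (\<alpha> - 1) * \<bar>x - u\<bar> powr (1 - \<alpha>) = 1"
    using assms(2) by (simp flip: powr_add)
  moreover have "\<bar>x - u\<bar> powr (\<alpha> - 1) * \<bar>x - u\<bar> = \<bar>x - u\<bar> powr \<alpha>"
    using assms(2) by (simp add: powr_diff)
  ultimately show ?thesis by simp
qed

text \<open>The Lebesgue integral agrees with the gauge integral once absolute integrability is
  known. \<open>f\<close> is bounded on the segment, and a constant times the kernel, integrable by
  the same substitution, dominates.\<close>

lemma set_lebesgue_integral_powr_segment:
  fixes f :: "real \<Rightarrow> real"
  assumes "0 < \<alpha>" and cont: "continuous_on (closed_segment u x) f"
  shows "(LINT y:closed_segment u x|lebesgue. \<bar>y - u\<bar> powr (\<alpha> - 1) * f y) =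
     \<bar>x - u\<bar> powr \<alpha> * integral {0..1} (\<lambda>t. t powr (\<alpha> - 1) * f (t * x + (1 - t) * u))"
proof (cases "u = x")
  case True
  \<comment> \<open>By convention \<open>0 powr (\<alpha> - 1) = 0\<close>, so the integrand
    vanishes even at the single point of the segment.\<close>
  then have "indicat_real (closed_segment u x) y *\<^sub>R (\<bar>y - u\<bar> powr (\<alpha> - 1) * f y) = 0" for y
    by (cases "y = x") auto
  then show ?thesis
    using True assms(1) by (simp only: set_lebesgue_integral_def) simp
next
  case False
  have "bounded (f ` closed_segment u x)"
    by (intro compact_imp_bounded compact_continuous_image cont) auto
  then obtain C where C: "\<And>y. y \<in> closed_segment u x \<Longrightarrow> \<bar>f y\<bar> \<le> C"
    unfolding bounded_iff by auto
  note f = has_integral_powr_segment[OF assms(1) False cont]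
  have "(\<lambda>y. \<bar>y - u\<bar> powr (\<alpha> - 1) * f y) absolutely_integrable_on closed_segment u x"
  proof (rule absolutely_integrable_integrable_bound)
    show "norm (\<bar>y - u\<bar> powr (\<alpha> - 1) * f y) \<le> \<bar>y - u\<bar> powr (\<alpha> - 1) * C" if "y \<in> closed_segment u x" for y
      using C[OF that] by (auto simp: abs_mult intro!: mult_left_mono)
    show "(\<lambda>y. \<bar>y - u\<bar> powr (\<alpha> - 1) * C) integrable_on closed_segment u x"
      using has_integral_powr_segment[OF assms(1) False, of "\<lambda>_. C"] by auto
  qed (use f in blast)
  from set_lebesgue_integral_eq_integral(2)[OF this] integral_unique[OF f] show ?thesis
    by simp
qed

text \<open>The recurrence \<open>Gamma (\<alpha> + 1) = \<alpha> * Gamma \<alpha>\<close> cancels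
  the normalising factors of the fractional integrals, and \<open>S_f\<close> separates into one
  expression taken at both endpoints.\<close>

lemma S_f_eq:
  fixes f :: "real \<Rightarrow> real" and lam :: real
  assumes "0 < \<alpha>" and x: "x \<in> {a..b}" and cont: "continuous_on {a..b} f"
  defines "E \<equiv> \<lambda>u. (1 - lam) * f x + lam * f u
      - \<alpha> * integral {0..1} (\<lambda>t. t powr (\<alpha> - 1) * f (t * x + (1 - t) * u))"
  shows "S_f f x lam \<alpha> a b = (x - a) powr \<alpha> / (b - a) * E a + (b - x) powr \<alpha> / (b - a) * E b"
proof -
  let ?J = "\<lambda>u. integral {0..1} (\<lambda>t. t powr (\<alpha> - 1) * f (t * x + (1 - t) * u))"
  have seg: "closed_segment a x = {a..x}" "closed_segment b x = {x..b}"
    using x by (auto simp: closed_segment_eq_real_ivl)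
  have G: "Gamma (\<alpha> + 1) = \<alpha> * Gamma \<alpha>" "Gamma \<alpha> > 0"
    using assms(1) by (auto simp: Gamma_plus1 Gamma_real_pos nonpos_Ints_def)
  have "(LINT t:{a..x}|lebesgue. (t - a) powr (\<alpha> - 1) * f t) =
      (LINT t:closed_segment a x|lebesgue. \<bar>t - a\<bar> powr (\<alpha> - 1) * f t)"
    unfolding seg set_lebesgue_integral_def by (intro Bochner_Integration.integral_cong) (auto simp: indicator_def)
  also have "\<dots> = (x - a) powr \<alpha> * ?J a"
    using x by (subst set_lebesgue_integral_powr_segment)
      (auto simp: seg assms(1) intro: continuous_on_subset[OF cont])
  finally have minus: "Gamma (\<alpha> + 1) * rl_integral_minus \<alpha> x f a = \<alpha> * ((x - a) powr \<alpha> * ?J a)"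
    using G by (simp add: rl_integral_minus_def)
  have "(LINT t:{x..b}|lebesgue. (b - t) powr (\<alpha> - 1) * f t) =
      (LINT t:closed_segment b x|lebesgue. \<bar>t - b\<bar> powr (\<alpha> - 1) * f t)"
    unfolding seg set_lebesgue_integral_def by (intro Bochner_Integration.integral_cong) (auto simp: indicator_def)
  also have "\<dots> = (b - x) powr \<alpha> * ?J b"
    using x by (subst set_lebesgue_integral_powr_segment)
      (auto simp: seg assms(1) intro: continuous_on_subset[OF cont])
  finally have plus: "Gamma (\<alpha> + 1) * rl_integral_plus \<alpha> x f b = \<alpha> * ((b - x) powr \<alpha> * ?J b)"
    using G by (simp add: rl_integral_plus_def)
  \<comment> \<open>Distributing \<open>Gamma (\<alpha> + 1)\<close> creates the products that
    \<open>minus\<close> and \<open>plus\<close> rewrite.\<close>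
  have "Gamma (\<alpha> + 1) / (b - a) * (rl_integral_minus \<alpha> x f a + rl_integral_plus \<alpha> x f b) =
      (Gamma (\<alpha> + 1) * rl_integral_minus \<alpha> x f a + Gamma (\<alpha> + 1) * rl_integral_plus \<alpha> x f b) / (b - a)"
    by (simp add: distrib_left add_divide_distrib)
  then show ?thesis
    unfolding S_f_def E_def minus plus by (simp add: field_simps add_divide_distrib diff_divide_distrib)
qed

section \<open>Combination of the estimates for \<open>u = a\<close> and
  \<open>u = b\<close>\<close>

theorem theorem4:
  fixes I :: "real set" and f :: "real \<Rightarrow> real" and a b s q x lam \<alpha> :: real
  assumes "is_interval I" and "I \<subseteq> {0..}"
    and "f differentiable_on interior I"
    and "a \<in> interior I" and "b \<in> interior I" and "a < b"
    and "set_integrable lebesgue {a..b} (deriv f)"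
    and "0 < s" and "s \<le> 1"
    and "1 \<le> q"
    and "s_convex_on s {a..b} (\<lambda>t. \<bar>deriv f t\<bar> powr q)"
    and "x \<in> {a..b}" and "lam \<in> {0..1}" and "0 < \<alpha>"
  shows "\<bar>S_f f x lam \<alpha> a b\<bar> \<le>
    A1 \<alpha> lam powr (1 - 1 / q) *
      ((x - a) powr (\<alpha> + 1) / (b - a) *
         (\<bar>deriv f x\<bar> powr q * A2 \<alpha> lam s + \<bar>deriv f a\<bar> powr q * A3 \<alpha> lam s) powr (1 / q)
       + (b - x) powr (\<alpha> + 1) / (b - a) *
         (\<bar>deriv f x\<bar> powr q * A2 \<alpha> lam s + \<bar>deriv f b\<bar> powr q * A3 \<alpha> lam s) powr (1 / q))"
proof -
  let ?d = "\<lambda>y. \<bar>deriv f y\<bar> powr q"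
  define M where "M u = A1 \<alpha> lam powr (1 - 1 / q) * (?d x * A2 \<alpha> lam s + ?d u * A3 \<alpha> lam s) powr (1 / q)" for u
  define E where "E u = (1 - lam) * f x + lam * f u
      - \<alpha> * integral {0..1} (\<lambda>t. t powr (\<alpha> - 1) * f (t * x + (1 - t) * u))" for u
  note x = assms(12)
  have "is_interval (interior I)"
    using assms(1) by (simp add: is_interval_convex_1)
  then have sub: "{a..b} \<subseteq> interior I"
    using assms(4,5) by (meson atLeastAtMost_iff mem_is_interval_1_I subsetI)
  \<comment> \<open>\<open>interior I\<close> is open, so \<open>f\<close> has a two-sided
    derivative at every point of \<open>{a..b}\<close>, endpoints included.\<close>
  have D: "(f has_real_derivative deriv f y) (at y)" if "y \<in> {a..b}" for y
    using assms(3) sub that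
    by (metis DERIV_deriv_iff_real_differentiable differentiable_on_eq_differentiable_at open_interior subsetD)
  then have cont: "continuous_on {a..b} f"
    by (meson DERIV_isCont continuous_at_imp_continuous_on)
  have E: "\<bar>E u\<bar> \<le> \<bar>x - u\<bar> * M u" if u: "u \<in> {a..b}" for u
    unfolding E_def M_def
  proof (rule segment_trapezoid_bound)
    have "closed_segment u x \<subseteq> {a..b}"
      using u x by (simp add: closed_segment_subset)
    then show "(f has_real_derivative deriv f y) (at y)" if "y \<in> closed_segment u x" for y
      using D that by blast
    \<comment> \<open>Convexity is applied with \<open>x\<close> as first point, which pairs
      \<open>?d x\<close> with \<open>A2\<close> and \<open>?d u\<close> with
      \<open>A3\<close>.\<close>
    show "?d (t * x + (1 - t) * u) \<le> t powr s * ?d x + (1 - t) powr s * ?d u" if "t \<in> {0..1}" for t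
      using assms(11) x u that unfolding s_convex_on_def by blast
  qed (use assms in auto)
  \<comment> \<open>\<open>d\<close> will be \<open>x - a\<close> or \<open>b - x\<close>; the
    factor \<open>\<bar>x - u\<bar>\<close> of the segment bound raises the exponent to
    \<open>\<alpha> + 1\<close>.\<close>
  have term_le: "\<bar>d powr \<alpha> / (b - a) * E u\<bar> \<le> d powr (\<alpha> + 1) / (b - a) * M u"
    if "u \<in> {a..b}" "d = \<bar>x - u\<bar>" for u d
  proof -
    have "\<bar>d powr \<alpha> / (b - a) * E u\<bar> \<le> d powr \<alpha> / (b - a) * (d * M u)"
    proof -
      have "\<bar>d powr \<alpha> / (b - a) * E u\<bar> = d powr \<alpha> / (b - a) * \<bar>E u\<bar>"
        using assms(6) by (simp add: abs_mult)
      also have "\<dots> \<le> d powr \<alpha> / (b - a) * (d * M u)"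
        using E[OF that(1)] that(2) assms(6) by (intro mult_left_mono) auto
      finally show ?thesis .
    qed
    also have "\<dots> = d powr (\<alpha> + 1) / (b - a) * M u"
      using that by (simp add: powr_add)
    finally show ?thesis .
  qed
  have "\<bar>S_f f x lam \<alpha> a b\<bar> \<le> (x - a) powr (\<alpha> + 1) / (b - a) * M a + (b - x) powr (\<alpha> + 1) / (b - a) * M b"
    unfolding S_f_eq[OF assms(14) x cont] E_def[symmetric]
    by (rule order_trans[OF abs_triangle_ineq]) (intro add_mono term_le; use x assms(6) in auto)
  then show ?thesis
    by (simp add: M_def algebra_simps)
qed

end
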